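(* Let $G$ be a nontrivial connected graph. Then $pvc(G)=2$ if and only if $diam(G)\geq 3$.
   Context: All graphs are simple, finite and undirected; nontrivial means having at least two vertices. Vertex-colorings are arbitrary (adjacent vertices may receive the same color). A path in a vertex-colored graph is a vertex-proper path if any two adjacent internal vertices of the path differ in color (the end-vertices of the path are not internal). A vertex-colored graph is proper vertex-connected if any two distinct vertices are joined by a vertex-proper path. For a connected graph $G$, $pvc(G)$ is the smallest number of colors required to make $G$ proper vertex-connected. The value $0$ is allowed: $pvc(G)=0$ means that no vertex needs to be colored, where an uncolored path counts as vertex-proper exactly when it has no internal vertices. $diam(G)$ is the maximum distance between two vertices of $G$. *)

theory Defs
  imports "Graph_Theory.Graph_Theory"
begin

text \<open>
  Finite simple undirected graphs are the locale \<^locale>\<open>graph\<close>: finite symmetric digraphs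
  without loops and without parallel arcs. Paths are lists of vertices
  (\<^const>\<open>vpath\<close>: consecutive vertices are adjacent and no vertex is repeated).
\<close>

definition internal_verts :: "'a vwalk \<Rightarrow> 'a list" where
  "internal_verts p = butlast (tl p)"

text \<open>
  \<open>None\<close> stands for the uncoloured graph, \<open>Some c\<close> for a colouring of all vertices, which need
  not be proper. In a coloured graph, vertex-properness only compares internal vertices that
  are consecutive on the path.
\<close>

fun vertex_proper :: "('a \<Rightarrow> nat) option \<Rightarrow> 'a vwalk \<Rightarrow> bool" where
  "vertex_proper None p \<longleftrightarrow> internal_verts p = []"
| "vertex_proper (Some c) p \<longleftrightarrow> successively (\<lambda>x y. c x \<noteq> c y) (internal_verts p)"

definition proper_vertex_connected ::
    "('a, 'b) pre_digraph \<Rightarrow> ('a \<Rightarrow> nat) option \<Rightarrow> bool" where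
  "proper_vertex_connected G col \<longleftrightarrow>
    (\<forall>u \<in> verts G. \<forall>v \<in> verts G. u \<noteq> v \<longrightarrow>
      (\<exists>p. vpath p G \<and> hd p = u \<and> last p = v \<and> vertex_proper col p))"

fun num_colours :: "('a, 'b) pre_digraph \<Rightarrow> ('a \<Rightarrow> nat) option \<Rightarrow> nat" where
  "num_colours G None = 0"
| "num_colours G (Some c) = card (c ` verts G)"

definition pvc :: "('a, 'b) pre_digraph \<Rightarrow> nat" where
  "pvc G = (LEAST k. \<exists>col. num_colours G col = k \<and> proper_vertex_connected G col)"

text \<open>
  With all arc weights 1, \<^const>\<open>wf_digraph.\<mu>\<close> is the usual graph distance, as an extended
  real.
\<close>

definition diam :: "('a, 'b) pre_digraph \<Rightarrow> ereal" where
  "diam G = (SUP (u, v) \<in> verts G \<times> verts G. wf_digraph.\<mu> G (\<lambda>_. 1) u v)"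

end

theory Submission
  imports Defs
begin

text \<open>
  Colouring each vertex by the parity of its distance to a fixed root makes every arc of a
  breadth-first spanning tree bichromatic, so two colours always suffice. With at most one colour,
  a vertex-proper path has at most one internal vertex, so at most one colour suffices exactly
  when all distances are at most 2.
\<close>

section \<open>Two colours from distance parity\<close>

text \<open>Breadth-first levels: \<open>d\<close> is the length of a shortest \<open>R\<close>-path
  to \<open>r\<close>, and \<open>w\<close> is the second vertex of such a path from
  \<open>v\<close>.\<close>

lemma rtrancl_level_function:
  assumes "\<And>v. v \<in> V \<Longrightarrow> (v, r) \<in> R\<^sup>*" and "R \<subseteq> V \<times> V"
  obtains d :: "'a \<Rightarrow> nat"
  where "\<And>v. \<lbrakk>v \<in> V; v \<noteq> r\<rbrakk> \<Longrightarrow> \<exists>w. (v, w) \<in> R \<and> d v = Suc (d w)"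
proof
  define d where "d v = (LEAST n. (v, r) \<in> R ^^ n)" for v
  fix v assume v: "v \<in> V" "v \<noteq> r"
  have d: "(x, r) \<in> R ^^ d x" if "x \<in> V" for x
    using assms(1)[OF that] LeastI_ex unfolding d_def rtrancl_power by metis
  obtain n where n: "d v = Suc n"
    using d[OF v(1)] v(2) by (cases "d v") auto
  with d[OF v(1)] obtain w where w: "(v, w) \<in> R" "(w, r) \<in> R ^^ n"
    by (metis relpow_Suc_D2)
  \<comment> \<open>The rest of the path from \<open>v\<close> bounds \<open>d w\<close> by
    \<open>n\<close>. Conversely, \<open>w\<close> lies in \<open>V\<close>, so \<open>d w\<close>
    is attained, and prefixing \<open>(v, w)\<close> bounds \<open>d v\<close> by
    \<open>Suc (d w)\<close>.\<close>
  then have "d w \<le> n" "w \<in> V"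
    using assms(2) by (auto simp: d_def intro: Least_le)
  moreover have "d v \<le> Suc (d w)"
    using relpow_Suc_I2[OF w(1) d[OF \<open>w \<in> V\<close>]] by (simp add: d_def[of v] Least_le)
  ultimately show "\<exists>w. (v, w) \<in> R \<and> d v = Suc (d w)"
    using n w(1) by (auto intro!: exI[of _ w])
qed

lemma vwalk_successively: "vwalk p G \<Longrightarrow> successively (\<lambda>x y. (x, y) \<in> arcs_ends G) p"
  by (induct p rule: vwalk_induct) auto

lemma successively_internal_verts: "successively P p \<Longrightarrow> successively P (internal_verts p)"
  unfolding internal_verts_def
  by (cases p; cases "tl p" rule: rev_cases) (auto simp: successively_Cons successively_append_iff)

lemma (in graph) ex_two_colouring:
  assumes "connected G"
  obtains c where "proper_vertex_connected G (Some c)" "c ` verts G \<subseteq> {0, 1}"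
proof -
  obtain r where r: "r \<in> verts G"
    using assms by (auto simp: connected_def strongly_connected_def)
  have reach: "(v, r) \<in> (arcs_ends G)\<^sup>*" if "v \<in> verts G" for v
    using symmetric_connected_imp_strongly_connected[OF sym_arcs assms] that r
    by (auto simp: strongly_connected_def intro: reachable_rtranclI)
  have sub: "arcs_ends G \<subseteq> verts G \<times> verts G"
    using adj_in_verts by auto
  obtain d :: "'a \<Rightarrow> nat" where
    d: "\<And>v. \<lbrakk>v \<in> verts G; v \<noteq> r\<rbrakk> \<Longrightarrow> \<exists>w. (v, w) \<in> arcs_ends G \<and> d v = Suc (d w)"
    using rtrancl_level_function[OF reach sub] by blast
  define c where "c v = d v mod 2" for v
  \<comment> \<open>Instead of choosing a spanning tree, \<open>H\<close> keeps every bichromatic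
    arc. Any path in \<open>H\<close> then alternates colours, so connectedness of \<open>H\<close>
    is all that remains.\<close>
  define H where "H = G\<lparr>arcs := {e \<in> arcs G. c (tail G e) \<noteq> c (head G e)}\<rparr>"
  have H_ends: "(x, y) \<in> arcs_ends H \<longleftrightarrow> (x, y) \<in> arcs_ends G \<and> c x \<noteq> c y" for x y
    by (auto simp: H_def arcs_ends_def arc_to_ends_def)
  interpret H: wf_digraph H
    by unfold_locales (auto simp: H_def)
  have "sym (arcs_ends H)"
    using sym_arcs by (auto simp: sym_def H_ends symmetric_def)
  then have sym: "symmetric H" by (simp add: symmetric_def)
  have to_root: "v \<rightarrow>\<^sup>*\<^bsub>H\<^esub> r" if "v \<in> verts G" for v
    using that
  proof (induction "d v" arbitrary: v rule: less_induct)
    case less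
    show ?case
    proof (cases "v = r")
      case True
      moreover have "r \<in> verts H" using r by (simp add: H_def)
      ultimately show ?thesis by simp
    next
      case False
      with d less.prems obtain w where w: "(v, w) \<in> arcs_ends G" "d v = Suc (d w)" by blast
      \<comment> \<open>The levels of \<open>v\<close> and \<open>w\<close> differ by one, so their
        parities differ and the arc survives in \<open>H\<close>.\<close>
      then have "(v, w) \<in> arcs_ends H" by (simp add: H_ends c_def) presburger
      moreover have "w \<rightarrow>\<^sup>*\<^bsub>H\<^esub> r"
        using less.hyps w adj_in_verts by simp
      ultimately show ?thesis by (rule H.adj_reachable_trans)
    qed
  qed
  have "proper_vertex_connected G (Some c)"
    unfolding proper_vertex_connected_def
  proof (intro ballI impI)
    fix u v assume "u \<in> verts G" "v \<in> verts G"
    \<comment> \<open>Go from \<open>u\<close> to the root and, by symmetry of \<open>H\<close>,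
      from the root to \<open>v\<close>. Repeated vertices are then removed inside \<open>H\<close>,
      so that the resulting path still uses bichromatic arcs only.\<close>
    then have "u \<rightarrow>\<^sup>*\<^bsub>H\<^esub> v"
      using H.reachable_trans to_root symmetric_reachable[OF sym] by blast
    then obtain p where p: "vpath p H" "hd p = u" "last p = v"
      using H.reachable_vpath_conv by blast
    have "vpath p G"
      using p(1) H_ends by (auto simp: vpath_def vwalk_def H_def)
    moreover have "successively (\<lambda>x y. c x \<noteq> c y) p"
      using vwalk_successively[of p H] p(1) H_ends
      by (auto simp: vpath_def elim: successively_mono)
    ultimately show "\<exists>p. vpath p G \<and> hd p = u \<and> last p = v \<and> vertex_proper (Some c) p"
      using p by (auto intro: successively_internal_verts)
  qed
  moreover have "c ` verts G \<subseteq> {0, 1}" by (auto simp: c_def)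
  ultimately show thesis by (rule that)
qed

section \<open>Diameter below three\<close>

text \<open>The link between the real-valued distance and short paths: diameter and colourings with
  at most one colour are both compared with this adjacency condition.\<close>

definition within_two :: "('a, 'b) pre_digraph \<Rightarrow> 'a \<Rightarrow> 'a \<Rightarrow> bool" where
  "within_two G u v \<longleftrightarrow>
    u = v \<or> u \<rightarrow>\<^bsub>G\<^esub> v \<or> (\<exists>w. u \<rightarrow>\<^bsub>G\<^esub> w \<and> w \<rightarrow>\<^bsub>G\<^esub> v)"

text \<open>An infimum below 3 is undercut by some walk of cost below 3. With unit weights the cost
  is the number of arcs, hence at most 2.\<close>

lemma (in wf_digraph) within_two_if_mu_less_3:
  assumes "\<mu> (\<lambda>_. 1) u v < 3"
  shows "within_two G u v"
proof -
  obtain p where p: "awalk u p v" "awalk_cost (\<lambda>_. 1) p < 3"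
    using assms by (auto simp: \<mu>_def INF_less_iff)
  have "awalk_cost (\<lambda>_. 1) p = real (length p)"
    by (induct p) auto
  with p(2) have "length p \<le> 2" by simp
  then consider "p = []" | e where "p = [e]" | e f where "p = [e, f]"
    by (cases p; cases "tl p") auto
  then show ?thesis
  proof cases
    case 3
    then have "u \<rightarrow>\<^bsub>G\<^esub> head G e" "head G e \<rightarrow>\<^bsub>G\<^esub> v"
      using p(1) in_arcs_imp_in_arcs_ends[of e] in_arcs_imp_in_arcs_ends[of f]
      by (auto simp: awalk_Cons_iff awalk_Nil_iff)
    then show ?thesis unfolding within_two_def by blast
  qed (use p(1) in \<open>auto simp: within_two_def awalk_Cons_iff awalk_Nil_iff
    dest: in_arcs_imp_in_arcs_ends\<close>)
qed

text \<open>A walk with at most two arcs bounds the infimum from above. For \<open>u = v\<close> it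
  is the empty walk, which requires \<open>u\<close> to be a vertex.\<close>

lemma (in wf_digraph) mu_le_2_if_within_two:
  assumes "within_two G u v" "u \<in> verts G"
  shows "\<mu> (\<lambda>_. 1) u v \<le> 2"
proof -
  have "\<exists>p. awalk u p v \<and> awalk_cost (\<lambda>_. 1) p \<le> 2"
    using assms(1) unfolding within_two_def
  proof (elim disjE exE conjE)
    assume "u = v"
    then show ?thesis using assms(2) by (intro exI[of _ "[]"]) (auto simp: awalk_Nil_iff)
  next
    assume "u \<rightarrow>\<^bsub>G\<^esub> v"
    then obtain e where "arc e (u, v)" by (auto simp: arcs_ends_conv arc_def)
    then show ?thesis by (intro exI[of _ "[e]"]) (auto simp: awalk_Cons_iff awalk_Nil_iff arc_def)
  next
    fix w assume "u \<rightarrow>\<^bsub>G\<^esub> w" "w \<rightarrow>\<^bsub>G\<^esub> v"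
    then obtain e f where "arc e (u, w)" "arc f (w, v)" by (auto simp: arcs_ends_conv arc_def)
    then show ?thesis
      by (intro exI[of _ "[e, f]"]) (auto simp: awalk_Cons_iff awalk_Nil_iff arc_def)
  qed
  then obtain p where p: "awalk u p v" "awalk_cost (\<lambda>_. 1) p \<le> 2" by blast
  have "\<mu> (\<lambda>_. 1) u v \<le> ereal (awalk_cost (\<lambda>_. 1) p)"
    by (rule min_cost_le_walk_cost[OF p(1)])
  also have "\<dots> \<le> ereal 2" using p(2) by (simp only: ereal_less_eq)
  finally show ?thesis by simp
qed

text \<open>A strict pointwise bound need not survive a supremum; here it does because distances
  below 3 are already at most 2.\<close>

lemma (in wf_digraph) diam_less_3_iff:
  "diam G < 3 \<longleftrightarrow> (\<forall>u\<in>verts G. \<forall>v\<in>verts G. within_two G u v)"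
proof (intro iffI ballI)
  fix u v assume "diam G < 3" and "u \<in> verts G" "v \<in> verts G"
  then have "\<mu> (\<lambda>_. 1) u v \<le> diam G"
    unfolding diam_def by (intro SUP_upper2[of "(u, v)"]) auto
  with \<open>diam G < 3\<close> show "within_two G u v"
    by (intro within_two_if_mu_less_3) (rule le_less_trans)
next
  assume "\<forall>u\<in>verts G. \<forall>v\<in>verts G. within_two G u v"
  then have "diam G \<le> 2"
    unfolding diam_def
    by (intro SUP_least) (auto simp del: numeral_eq_ereal intro: mu_le_2_if_within_two)
  also have "(2 :: ereal) < 3" by simp
  finally show "diam G < 3" .
qed

section \<open>At most one colour\<close>

lemma length_internal_verts: "length (internal_verts p) = length p - 2"
  by (simp add: internal_verts_def)

lemma within_two_if_short_vwalk:
  assumes "vwalk p G" "length p \<le> 3"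
  shows "within_two G (hd p) (last p)"
proof -
  have "p \<noteq> []" using assms(1) by auto
  with assms(2) consider x where "p = [x]" | x y where "p = [x, y]" | x y z where "p = [x, y, z]"
    by (cases p; cases "tl p"; cases "tl (tl p)") auto
  then show ?thesis
    using assms(1) by cases (auto simp: within_two_def vwalk_def)
qed

lemma (in digraph) short_vpath_if_within_two:
  assumes "within_two G u v" "u \<in> verts G"
  obtains p where "vpath p G" "hd p = u" "last p = v" "length p \<le> 3"
proof (cases "u = v \<or> u \<rightarrow>\<^bsub>G\<^esub> v")
  case True
  then show thesis
  proof
    assume "u = v"
    then show thesis using assms(2) by (intro that[of "[u]"]) (auto simp: vpath_def vwalk_def)
  next
    assume "u \<rightarrow>\<^bsub>G\<^esub> v"
    then show thesis
      using adj_in_verts adj_not_same by (intro that[of "[u, v]"]) (auto simp: vpath_def vwalk_def)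
  qed
next
  \<comment> \<open>The failed case gives \<open>u \<noteq> v\<close>, and \<open>w\<close> differs
    from both since there are no loops, so \<open>[u, w, v]\<close> repeats no vertex.\<close>
  case False
  then obtain w where "u \<rightarrow>\<^bsub>G\<^esub> w" "w \<rightarrow>\<^bsub>G\<^esub> v"
    using assms(1) by (auto simp: within_two_def)
  with False show thesis
    using adj_in_verts adj_not_same by (intro that[of "[u, w, v]"]) (auto simp: vpath_def vwalk_def)
qed

text \<open>Without colours there is no internal vertex; with one colour, two consecutive internal
  vertices would clash. Either way at most one is left besides the two ends.\<close>

lemma (in fin_digraph) length_monochromatic_vertex_proper:
  assumes "vpath p G" "vertex_proper col p" "num_colours G col \<le> 1"
  shows "length p \<le> 3"
proof (cases col)
  case None
  then show ?thesis using assms(2) length_internal_verts[of p] by simp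
next
  case (Some c)
  \<comment> \<open>\<open>num_colours\<close> only counts colours on \<open>verts G\<close>, so the
    internal vertices must be located there before their colours can be equated.\<close>
  have "set (internal_verts p) \<subseteq> verts G"
    using assms(1) unfolding internal_verts_def
    by (auto simp: vpath_def vwalk_def dest!: in_set_butlastD list.set_sel(2)[rotated])
  moreover have "card (c ` verts G) \<le> Suc 0"
    using assms(3) Some by simp
  then have mono: "c x = c y" if "x \<in> verts G" "y \<in> verts G" for x y
    using that iffD1[OF card_le_Suc0_iff_eq[OF finite_imageI[OF finite_verts]]] by blast
  moreover have "successively (\<lambda>x y. c x \<noteq> c y) (internal_verts p)"
    using assms(2) Some by simp
  ultimately have "length (internal_verts p) \<le> 1"
  proof (cases "internal_verts p" rule: remdups_adj.cases)
    case (3 x y zs)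
    with \<open>set (internal_verts p) \<subseteq> verts G\<close> have "c x = c y"
      by (intro mono) auto
    with \<open>successively _ _\<close> 3 have False by (simp only: successively.simps) blast
    then show ?thesis ..
  qed simp_all
  then show ?thesis using length_internal_verts[of p] by simp
qed

lemma (in digraph) proper_vertex_connected_one_colour_iff:
  "(\<exists>col. num_colours G col \<le> 1 \<and> proper_vertex_connected G col) \<longleftrightarrow>
    (\<forall>u\<in>verts G. \<forall>v\<in>verts G. within_two G u v)"
proof (intro iffI ballI)
  fix u v
  assume "\<exists>col. num_colours G col \<le> 1 \<and> proper_vertex_connected G col"
    and "u \<in> verts G" "v \<in> verts G"
  \<comment> \<open>Proper connection only concerns distinct vertices; for \<open>u = v\<close> the
    first disjunct of \<open>within_two\<close> applies.\<close>
  then show "within_two G u v"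
    using length_monochromatic_vertex_proper within_two_if_short_vwalk
    unfolding proper_vertex_connected_def vpath_def by (metis within_two_def)
next
  assume all: "\<forall>u\<in>verts G. \<forall>v\<in>verts G. within_two G u v"
  \<comment> \<open>The constant colouring works at distance 2 as well as at distance 1: a single
    internal vertex has nothing to be compared with. Values 0 and 1 of \<open>pvc\<close> thus need
    not be told apart.\<close>
  have "proper_vertex_connected G (Some (\<lambda>_. 0))"
    unfolding proper_vertex_connected_def
  proof (intro ballI impI)
    fix u v assume "u \<in> verts G" "v \<in> verts G"
    with all obtain p where p: "vpath p G" "hd p = u" "last p = v" "length p \<le> 3"
      using short_vpath_if_within_two by blast
    then have "length (internal_verts p) \<le> 1"
      by (simp add: length_internal_verts)
    then have "vertex_proper (Some (\<lambda>_. 0)) p"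
      by (cases "internal_verts p") auto
    with p show "\<exists>p. vpath p G \<and> hd p = u \<and> last p = v \<and> vertex_proper (Some (\<lambda>_. 0)) p"
      by blast
  qed
  moreover have "num_colours G (Some (\<lambda>_. 0)) \<le> 1"
    using card_mono[of "{0}" "(\<lambda>_. 0 :: nat) ` verts G"] by auto
  ultimately show "\<exists>col. num_colours G col \<le> 1 \<and> proper_vertex_connected G col"
    by blast
qed

text \<open>The assumption makes the set under \<open>LEAST\<close> nonempty, so the minimum is
  attained and can be used as a threshold.\<close>

lemma pvc_le_iff:
  assumes "proper_vertex_connected G col"
  shows "pvc G \<le> k \<longleftrightarrow> (\<exists>col. num_colours G col \<le> k \<and> proper_vertex_connected G col)"
proof
  have "\<exists>col. num_colours G col = pvc G \<and> proper_vertex_connected G col"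
    unfolding pvc_def by (rule LeastI_ex) (use assms in blast)
  then show "pvc G \<le> k \<Longrightarrow> \<exists>col. num_colours G col \<le> k \<and> proper_vertex_connected G col"
    by metis
next
  show "\<exists>col. num_colours G col \<le> k \<and> proper_vertex_connected G col \<Longrightarrow> pvc G \<le> k"
    unfolding pvc_def by (auto intro: Least_le le_trans)
qed

theorem theorem1:
  fixes G :: "('a, 'b) pre_digraph"
  assumes "graph G"
    and "Digraph_Component.connected G"
    and "card (verts G) \<ge> 2"
  shows "pvc G = 2 \<longleftrightarrow> diam G \<ge> 3"
proof -
  interpret graph G by fact
  obtain c where c: "proper_vertex_connected G (Some c)" "c ` verts G \<subseteq> {0, 1}"
    using ex_two_colouring[OF assms(2)] .
  have "num_colours G (Some c) \<le> 2"
    using card_mono[OF _ c(2)] by simp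
  with c(1) have "pvc G \<le> 2"
    using pvc_le_iff[OF c(1)] by blast
  \<comment> \<open>Given \<open>pvc G \<le> 2\<close>, the value 2 is exactly the failure of
    \<open>pvc G \<le> 1\<close>, that is, of \<open>diam G < 3\<close>.\<close>
  moreover have "pvc G \<le> 1 \<longleftrightarrow> diam G < 3"
    using pvc_le_iff[OF c(1)] proper_vertex_connected_one_colour_iff diam_less_3_iff by simp
  ultimately show ?thesis by (auto simp: not_less[symmetric])
qed

end
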